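(* Let $D$ be the discrete open book with wedge point $x_0$. For each $i\in\mathbb N$ let $s_i$ be the sequence in $D$ based at $x_0$ and lying on $D_i$ whose $n$-th term is $s_{in}=in\in D_i$, $n\in\mathbb N\cup\{0\}$. Let $N\ge 1$ be an integer. Then $\sigma_N(D,x_0)=\{[s_1]_N,[s_2]_N,\ldots,[s_N]_N\}$.
   Context: Here $\mathbb N=\{1,2,3,\ldots\}$. Metric wedge. Given pointed metric spaces $(X_\alpha,x_\alpha)$, their metric wedge $\bigvee(X_\alpha,x_\alpha)$ is the wedge (disjoint union with all the points $x_\alpha$ identified to one point) with metric $d(x,y)=d_{X_\alpha}(x,y)$ if $x,y\in X_\alpha$ for some $\alpha$, and $d(x,y)=d_{X_\alpha}(x,x_\alpha)+d_{X_\beta}(x_\beta,y)$ if $x\in X_\alpha$, $y\in X_\beta$ with $\alpha\ne\beta$. Discrete open book. For $i\in\mathbb N$ let $D_i=\{in:n\in\mathbb N\cup\{0\}\}$ with the metric from $\mathbb R$. The discrete open book $D$ is the metric wedge $\bigvee_{i\in\mathbb N}(D_i,0)$; its wedge point is denoted $x_0$. The sets $\sigma_N$. Let $X$ be a metric space, $x_0\in X$, $N>0$. An $N$-sequence in $X$ based at $x_0$ is an infinite sequence $x_0,x_1,x_2,\ldots$ of points of $X$ (with initial term $x_0$) such that $d(x_i,x_{i+1})\le N$ for all $i\ge 0$. It goes to infinity if $\lim_{i\to\infty}d(x_i,x_0)=\infty$. For $N$-sequences $s,t$ based at $x_0$ that go to infinity, write $s\sim t$ if $s$ is a subsequence of $t$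 or $t$ is a subsequence of $s$; write $s\approx t$ if there is a finite list $t_1,\ldots,t_n$ of $N$-sequences in $X$ based at $x_0$ going to infinity with $s\sim t_1\sim\cdots\sim t_n\sim t$. Then $\approx$ is an equivalence relation; $[s]_N$ denotes the class of $s$ and $\sigma_N(X,x_0)$ the set of classes. *)

theory Defs
  imports "HOL-Analysis.Analysis"
begin

text \<open>
  The wedge of pointed metric spaces \<open>(X i, b i)\<close>, \<open>i \<in> I\<close>, is encoded with one canonical
  representative per point: \<open>None\<close> is the common base point, and \<open>Some (i, p)\<close> is the point
  \<open>p \<noteq> b i\<close> of \<open>X i\<close>. The map \<open>wedge_incl b i\<close> is the canonical map of \<open>X i\<close> into the wedge.
\<close>

definition wedge_incl :: "('i \<Rightarrow> 'a) \<Rightarrow> 'i \<Rightarrow> 'a \<Rightarrow> ('i \<times> 'a) option" where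
  "wedge_incl b i p = (if p = b i then None else Some (i, p))"

definition wedge_carrier :: "'i set \<Rightarrow> ('i \<Rightarrow> 'a metric) \<Rightarrow> ('i \<Rightarrow> 'a) \<Rightarrow> ('i \<times> 'a) option set" where
  "wedge_carrier I X b = insert None (\<Union>i\<in>I. wedge_incl b i ` mspace (X i))"

fun wedge_dist ::
  "('i \<Rightarrow> 'a metric) \<Rightarrow> ('i \<Rightarrow> 'a) \<Rightarrow> ('i \<times> 'a) option \<Rightarrow> ('i \<times> 'a) option \<Rightarrow> real" where
  "wedge_dist X b None None = 0"
| "wedge_dist X b None (Some (j, q)) = mdist (X j) (b j) q"
| "wedge_dist X b (Some (i, p)) None = mdist (X i) p (b i)"
| "wedge_dist X b (Some (i, p)) (Some (j, q)) =
     (if i = j then mdist (X i) p q else mdist (X i) p (b i) + mdist (X j) (b j) q)"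

definition metric_wedge ::
  "'i set \<Rightarrow> ('i \<Rightarrow> 'a metric) \<Rightarrow> ('i \<Rightarrow> 'a) \<Rightarrow> ('i \<times> 'a) option metric" where
  "metric_wedge I X b = metric (wedge_carrier I X b, wedge_dist X b)"

lemma wedge_carrier_cases:
  assumes "w \<in> wedge_carrier I X b"
  obtains "w = None" | i p where "w = Some (i, p)" "i \<in> I" "p \<in> mspace (X i)" "p \<noteq> b i"
  using assms by (auto simp: wedge_carrier_def wedge_incl_def split: if_splits)

lemma Metric_space_wedge:
  assumes b: "\<And>i. i \<in> I \<Longrightarrow> b i \<in> mspace (X i)"
  shows "Metric_space (wedge_carrier I X b) (wedge_dist X b)"
proof
  show "0 \<le> wedge_dist X b v w" for v w
    by (induction X b v w rule: wedge_dist.induct) auto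
  show "wedge_dist X b v w = wedge_dist X b w v" for v w
    by (induction X b v w rule: wedge_dist.induct) (auto simp: mdist_commute)
next
  fix v w assume "v \<in> wedge_carrier I X b" "w \<in> wedge_carrier I X b"
  then show "(wedge_dist X b v w = 0) = (v = w)"
    by (elim wedge_carrier_cases)
       (auto simp: b add_nonneg_eq_0_iff mdist_zero)
next
  fix u v w
  assume u: "u \<in> wedge_carrier I X b" and v: "v \<in> wedge_carrier I X b"
    and w: "w \<in> wedge_carrier I X b"
  have tri: "mdist (X i) p r \<le> mdist (X i) p q + mdist (X i) q r"
    if "p \<in> mspace (X i)" "q \<in> mspace (X i)" "r \<in> mspace (X i)" for i p q r
    using that by (rule mdist_triangle)
  show "wedge_dist X b u w \<le> wedge_dist X b u v + wedge_dist X b v w"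
    using u
  proof (cases rule: wedge_carrier_cases)
    case 1
    note u1 = this
    from v show ?thesis
    proof (cases rule: wedge_carrier_cases)
      case 1 with u1 w show ?thesis by (elim wedge_carrier_cases) auto
    next
      case (2 j q)
      with u1 w b[of j] tri[of "b j" j q] show ?thesis
        by (elim wedge_carrier_cases) auto
    qed
  next
    case (2 i p)
    note u2 = this
    from v show ?thesis
    proof (cases rule: wedge_carrier_cases)
      case 1
      with u2 w b[of i] tri[of p i "b i"] show ?thesis
        by (elim wedge_carrier_cases) auto
    next
      case (2 j q)
      from w show ?thesis
      proof (cases rule: wedge_carrier_cases)
        case 1
        with u2 2 b[of i] tri[of p i q "b i"] show ?thesis by auto
      next
        case (2 k r)
        with u2 \<open>v = Some (j, q)\<close> \<open>j \<in> I\<close> \<open>q \<in> mspace (X j)\<close>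
        show ?thesis
          using b[of i] b[of j] b[of k] tri[of p i q r] tri[of p i q "b i"] tri[of "b j" j q r]
            tri[of p i "b i" r] mdist_commute[of "X j" q "b j"] mdist_nonneg[of "X j" q "b j"]
          by (smt (verit, best) wedge_dist.simps(4))
      qed
    qed
  qed
qed

lemma mspace_metric_wedge:
  assumes "\<And>i. i \<in> I \<Longrightarrow> b i \<in> mspace (X i)"
  shows "mspace (metric_wedge I X b) = wedge_carrier I X b"
  unfolding metric_wedge_def by (rule Metric_space.mspace_metric[OF Metric_space_wedge[OF assms]])

lemma mdist_metric_wedge:
  assumes "\<And>i. i \<in> I \<Longrightarrow> b i \<in> mspace (X i)"
  shows "mdist (metric_wedge I X b) = wedge_dist X b"
  unfolding metric_wedge_def by (rule Metric_space.mdist_metric[OF Metric_space_wedge[OF assms]])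

lemma mdist_metric_wedge_incl:
  assumes b: "\<And>i. i \<in> I \<Longrightarrow> b i \<in> mspace (X i)"
    and "i \<in> I" "j \<in> I" "p \<in> mspace (X i)" "q \<in> mspace (X j)"
  shows "mdist (metric_wedge I X b) (wedge_incl b i p) (wedge_incl b j q) =
    (if i = j then mdist (X i) p q else mdist (X i) p (b i) + mdist (X j) (b j) q)"
proof -
  have "mdist (X k) (b k) (b k) = 0" if "k \<in> I" for k
    using b[OF that] by simp
  with assms(2,3) show ?thesis
    by (auto simp: mdist_metric_wedge[OF b] wedge_incl_def)
qed

definition discrete_page :: "nat \<Rightarrow> real metric" where
  "discrete_page i = submetric euclidean_metric (range (\<lambda>n::nat. real i * real n))"

definition discrete_open_book :: "(nat \<times> real) option metric" where
  "discrete_open_book = metric_wedge {1..} discrete_page (\<lambda>_. 0)"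

abbreviation book_point :: "(nat \<times> real) option" where
  "book_point \<equiv> None"

definition page_seq :: "nat \<Rightarrow> nat \<Rightarrow> (nat \<times> real) option" where
  "page_seq i n = wedge_incl (\<lambda>_. 0) i (real i * real n)"

lemma base_in_discrete_page: "0 \<in> mspace (discrete_page i)"
  by (auto simp: discrete_page_def intro: range_eqI[of _ _ 0])

definition N_sequences_to_infinity :: "real \<Rightarrow> 'a metric \<Rightarrow> 'a \<Rightarrow> (nat \<Rightarrow> 'a) set" where
  "N_sequences_to_infinity N X x0 =
    {s. s 0 = x0 \<and> range s \<subseteq> mspace X \<and> (\<forall>i. mdist X (s i) (s (Suc i)) \<le> N) \<and>
        filterlim (\<lambda>i. mdist X (s i) x0) at_top sequentially}"

definition is_subsequence :: "(nat \<Rightarrow> 'a) \<Rightarrow> (nat \<Rightarrow> 'a) \<Rightarrow> bool" where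
  "is_subsequence s t \<longleftrightarrow> (\<exists>r. strict_mono r \<and> s = t \<circ> r)"

definition seq_sim :: "(nat \<Rightarrow> 'a) \<Rightarrow> (nat \<Rightarrow> 'a) \<Rightarrow> bool" where
  "seq_sim s t \<longleftrightarrow> is_subsequence s t \<or> is_subsequence t s"

text \<open>
  Allowing the list \<open>ts\<close> of intermediate sequences to be empty changes nothing, because
  \<^const>\<open>seq_sim\<close> is reflexive.
\<close>

definition seq_equiv :: "real \<Rightarrow> 'a metric \<Rightarrow> 'a \<Rightarrow> ((nat \<Rightarrow> 'a) \<times> (nat \<Rightarrow> 'a)) set" where
  "seq_equiv N X x0 =
    {(s, t). s \<in> N_sequences_to_infinity N X x0 \<and> t \<in> N_sequences_to_infinity N X x0 \<and>
       (\<exists>ts. set ts \<subseteq> N_sequences_to_infinity N X x0 \<and> successively seq_sim (s # ts @ [t]))}"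

definition seq_class :: "real \<Rightarrow> 'a metric \<Rightarrow> 'a \<Rightarrow> (nat \<Rightarrow> 'a) \<Rightarrow> (nat \<Rightarrow> 'a) set" where
  "seq_class N X x0 s = seq_equiv N X x0 `` {s}"

definition sigma_ends :: "real \<Rightarrow> 'a metric \<Rightarrow> 'a \<Rightarrow> (nat \<Rightarrow> 'a) set set" where
  "sigma_ends N X x0 = N_sequences_to_infinity N X x0 // seq_equiv N X x0"

lemma seq_sim_refl: "seq_sim s s"
  by (auto simp: seq_sim_def is_subsequence_def strict_mono_def intro!: exI[of _ id])

lemma seq_sim_sym: "seq_sim s t \<Longrightarrow> seq_sim t s"
  by (auto simp: seq_sim_def)

lemma equiv_seq_equiv: "equiv (N_sequences_to_infinity N X x0) (seq_equiv N X x0)"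
proof (rule equivI)
  show "seq_equiv N X x0 \<subseteq> N_sequences_to_infinity N X x0 \<times> N_sequences_to_infinity N X x0"
    by (auto simp: seq_equiv_def)
  show "refl_on (N_sequences_to_infinity N X x0) (seq_equiv N X x0)"
    by (auto simp: refl_on_def seq_equiv_def seq_sim_refl intro!: exI[of _ "[]"])
  show "sym (seq_equiv N X x0)"
  proof (rule symI)
    fix s t assume "(s, t) \<in> seq_equiv N X x0"
    then obtain ts where ts: "s \<in> N_sequences_to_infinity N X x0"
        "t \<in> N_sequences_to_infinity N X x0" "set ts \<subseteq> N_sequences_to_infinity N X x0"
        "successively seq_sim (s # ts @ [t])"
      by (auto simp: seq_equiv_def)
    have "(\<lambda>x y. seq_sim y x) = (seq_sim :: (nat \<Rightarrow> 'a) \<Rightarrow> _)"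
      using seq_sim_sym by (intro ext) blast
    with ts(4) have "successively seq_sim (rev (s # ts @ [t]))"
      by (simp only: successively_rev)
    then have "successively seq_sim (t # rev ts @ [s])"
      by simp
    with ts(1-3) show "(t, s) \<in> seq_equiv N X x0"
      unfolding seq_equiv_def by (auto intro!: exI[of _ "rev ts"])
  qed
  show "trans (seq_equiv N X x0)"
  proof (rule transI)
    fix s t u assume "(s, t) \<in> seq_equiv N X x0" "(t, u) \<in> seq_equiv N X x0"
    then obtain ts us where *: "s \<in> N_sequences_to_infinity N X x0"
        "t \<in> N_sequences_to_infinity N X x0" "u \<in> N_sequences_to_infinity N X x0"
        "set ts \<subseteq> N_sequences_to_infinity N X x0" "set us \<subseteq> N_sequences_to_infinity N X x0"
        "successively seq_sim (s # ts @ [t])" "successively seq_sim (t # us @ [u])"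
      by (auto simp: seq_equiv_def)
    from *(6,7) have "successively seq_sim ((s # ts) @ (t # us @ [u]))"
      unfolding append_Cons[symmetric] successively_append_iff by auto
    with *(1-5) show "(s, u) \<in> seq_equiv N X x0"
      unfolding seq_equiv_def by (auto intro!: exI[of _ "ts @ t # us"])
  qed
qed

end

theory Submission
  imports Defs
begin

text \<open>
  Every \<open>N\<close>-sequence to infinity is joined to one of \<open>s\<^sub>1, \<dots>, s\<^sub>N\<close> by alternately passing to
  supersequences (inserting points) and to subsequences (discarding points).

  An \<open>N\<close>-sequence \<open>s\<close> in the book may hop from one page to another without visiting the wedge
  point. The distance between points of different pages is measured through the wedge point,
  so inserting that point at every change of page produces an \<open>N\<close>-sequence \<open>u\<close> that contains \<open>s\<close>.
  As \<open>u\<close> goes to infinity, it visits the wedge point for a last time. The tail of \<open>u\<close> that begins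
  there is again based at the wedge point, is a subsequence of \<open>u\<close>, and never changes
  page: it has the form \<open>page_seq i \<circ> f\<close> (\<open>N_sequence_equiv_on_one_page\<close>).

  Distinct points of the page \<open>i\<close> are at distance at least \<open>i\<close>, so a sequence on it with steps of
  length at most \<open>N\<close> is constant if \<open>i > N\<close>; hence \<open>i \<le> N\<close> (\<open>unbounded_walk_page_le\<close>). Then all
  points of the page that are skipped by a jump of \<open>f\<close> can be inserted, which gives a walk
  \<open>page_seq i \<circ> g\<close> where \<open>g\<close> changes by at most one at each step. Such a \<open>g\<close> starts at 0 and tends to
  infinity, so it takes all natural numbers as values, and for the first time in increasing
  order; the first hitting times exhibit \<open>page_seq i\<close> as a subsequence of the walk
  (\<open>page_walk_equiv_page_seq\<close>).
\<close>

section \<open>Subdividing sequences\<close>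

lemma seq_equivI:
  assumes "s \<in> N_sequences_to_infinity N X x0" "t \<in> N_sequences_to_infinity N X x0" "seq_sim s t"
  shows "(s, t) \<in> seq_equiv N X x0"
  using assms unfolding seq_equiv_def by (auto intro!: exI[of _ "[]"])

text \<open>
  The paths \<open>P 0, P 1, \<dots>\<close>, each made of \<open>L\<close> steps, are traversed one after the other. A fixed
  length \<open>L\<close> allows closed formulas with \<open>div\<close> and \<open>mod\<close>; a path that needs fewer steps waits
  at one of its points. The end point \<open>P k L\<close> is listed only as \<open>P (Suc k) 0\<close>.
\<close>
definition concat_paths :: "nat \<Rightarrow> (nat \<Rightarrow> nat \<Rightarrow> 'a) \<Rightarrow> nat \<Rightarrow> 'a" where
  "concat_paths L P n = P (n div L) (n mod L)"

lemma concat_paths_step: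
  assumes "L > 0" and join: "\<And>k. P k L = P (Suc k) 0"
  obtains k r where "r < L" "concat_paths L P n = P k r" "concat_paths L P (Suc n) = P k (Suc r)"
proof
  show "n mod L < L" using \<open>L > 0\<close> by simp
  show "concat_paths L P n = P (n div L) (n mod L)" by (simp add: concat_paths_def)
  show "concat_paths L P (Suc n) = P (n div L) (Suc (n mod L))"
    using join[of "n div L"] by (auto simp: concat_paths_def div_Suc mod_Suc)
qed

text \<open>
  Subdividing every step of \<open>s\<close> into the same number \<open>L\<close> of steps does not leave its class. The
  new sequence still goes to infinity, since it stays within \<open>L * N\<close> of \<open>s\<close>.
\<close>
lemma concat_paths_N_sequence:
  assumes s: "s \<in> N_sequences_to_infinity N X x0" and x0: "x0 \<in> mspace X" and L: "L > 0"
    and start: "\<And>k. P k 0 = s k" and finish: "\<And>k. P k L = s (Suc k)"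
    and space: "\<And>k r. P k r \<in> mspace X"
    and step: "\<And>k r. r < L \<Longrightarrow> mdist X (P k r) (P k (Suc r)) \<le> N"
  shows "concat_paths L P \<in> N_sequences_to_infinity N X x0"
    and "(s, concat_paths L P) \<in> seq_equiv N X x0"
proof -
  let ?u = "concat_paths L P"
  have join: "P k L = P (Suc k) 0" for k by (simp add: start finish)
  have "N \<ge> 0" using step[OF L, of 0] mdist_nonneg[of X] order_trans by blast
  have drift: "mdist X (s k) (P k r) \<le> real r * N" if "r \<le> L" for k r
    using that
  proof (induction r)
    case 0
    have "mdist X (s k) (s k) = 0" using space[of k 0] by (simp add: start)
    then show ?case by (simp add: start)
  next
    case (Suc r)
    have "mdist X (s k) (P k (Suc r)) \<le> mdist X (s k) (P k r) + mdist X (P k r) (P k (Suc r))"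
      using space[of k] start[of k] by (metis mdist_triangle)
    with Suc step[of r k] show ?case by (simp add: algebra_simps)
  qed
  have lower: "mdist X (s (n div L)) x0 - real L * N \<le> mdist X (?u n) x0" for n
  proof -
    let ?k = "n div L" and ?r = "n mod L"
    have "?r \<le> L" using L by (simp add: less_imp_le)
    then have "mdist X (s ?k) (P ?k ?r) \<le> real L * N"
      using drift[of ?r ?k] mult_right_mono[of "real ?r" "real L" N] \<open>N \<ge> 0\<close> by linarith
    moreover have "mdist X (s ?k) x0 \<le> mdist X (s ?k) (P ?k ?r) + mdist X (P ?k ?r) x0"
      using space[of ?k] start[of ?k] x0 by (metis mdist_triangle)
    ultimately show ?thesis by (simp add: concat_paths_def)
  qed
  have "filterlim (\<lambda>i. mdist X (s i) x0) at_top sequentially"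
    using s by (simp add: N_sequences_to_infinity_def)
  then have "filterlim (\<lambda>n. mdist X (s (n div L)) x0) at_top sequentially"
    using filterlim_compose filterlim_at_top_div_const_nat[OF L] by blast
  then have "filterlim (\<lambda>n. mdist X (s (n div L)) x0 - real L * N) at_top sequentially"
    using filterlim_tendsto_add_at_top[OF tendsto_const, of _ _ "- (real L * N)"] by simp
  then have "filterlim (\<lambda>n. mdist X (?u n) x0) at_top sequentially"
    by (rule filterlim_at_top_mono) (simp add: lower)
  moreover have "mdist X (?u n) (?u (Suc n)) \<le> N" for n
    by (rule concat_paths_step[where P = P and n = n, OF L join]) (simp add: step)
  moreover have "?u 0 = x0"
    using s by (simp add: concat_paths_def start N_sequences_to_infinity_def)
  ultimately show u: "?u \<in> N_sequences_to_infinity N X x0"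
    using space by (auto simp: N_sequences_to_infinity_def concat_paths_def)
  have "s = ?u \<circ> (\<lambda>k. k * L)"
    using L by (auto simp: concat_paths_def start)
  moreover have "strict_mono (\<lambda>k. k * L)"
    using L by (auto simp: strict_mono_def)
  ultimately have "is_subsequence s ?u"
    unfolding is_subsequence_def by blast
  then show "(s, ?u) \<in> seq_equiv N X x0"
    using s u by (intro seq_equivI) (auto simp: seq_sim_def)
qed

section \<open>Coordinates on the open book\<close>

lemma page_seq_0 [simp]: "page_seq i 0 = None"
  by (simp add: page_seq_def wedge_incl_def)

lemma page_seq_eq_None_iff: "i \<ge> 1 \<Longrightarrow> page_seq i n = None \<longleftrightarrow> n = 0"
  by (auto simp: page_seq_def wedge_incl_def)

lemma page_seq_eq_imp_same_page:
  "page_seq i m = page_seq j n \<Longrightarrow> page_seq i m \<noteq> None \<Longrightarrow> i = j"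
  by (auto simp: page_seq_def wedge_incl_def split: if_splits)

lemma mspace_discrete_open_book:
  "mspace discrete_open_book = {page_seq i n | i n. i \<ge> 1}"
proof -
  have "mspace discrete_open_book = wedge_carrier {1..} discrete_page (\<lambda>_. 0)"
    unfolding discrete_open_book_def by (intro mspace_metric_wedge base_in_discrete_page)
  also have "\<dots> = insert None (\<Union>i\<in>{1..}. range (page_seq i))"
    by (auto simp: wedge_carrier_def discrete_page_def page_seq_def)
  also have "\<dots> = {page_seq i n | i n. i \<ge> 1}"
    using page_seq_0[of 1, symmetric] atLeast_iff[of _ "1::nat"] by blast
  finally show ?thesis .
qed

lemma page_seq_in_book: "i \<ge> 1 \<Longrightarrow> page_seq i n \<in> mspace discrete_open_book"
  by (auto simp: mspace_discrete_open_book)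

lemma book_point_in_book: "book_point \<in> mspace discrete_open_book"
  using page_seq_in_book[of 1 0] by simp

text \<open>
  The points of the book are handled from here on through the two coordinates of
  \<open>page_seq i n\<close>, for which the base point is the case \<open>n = 0\<close> on every page.
\<close>
lemma mdist_page_seq:
  assumes "i \<ge> 1" "j \<ge> 1"
  shows "mdist discrete_open_book (page_seq i m) (page_seq j n) =
    (if i = j then real i * \<bar>real m - real n\<bar> else real i * real m + real j * real n)"
proof -
  have "mdist discrete_open_book (page_seq i m) (page_seq j n) =
    (if i = j then mdist (discrete_page i) (real i * real m) (real i * real n)
     else mdist (discrete_page i) (real i * real m) 0 + mdist (discrete_page j) 0 (real j * real n))"
    unfolding discrete_open_book_def page_seq_def using assms
    by (subst mdist_metric_wedge_incl) (auto simp: base_in_discrete_page discrete_page_def)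
  then show ?thesis
    by (auto simp: discrete_page_def dist_real_def abs_mult right_diff_distrib[symmetric])
qed

lemma mdist_page_seq_book_point:
  assumes "i \<ge> 1"
  shows "mdist discrete_open_book (page_seq i m) book_point = real i * real m"
  using mdist_page_seq[OF assms assms, of m 0] by simp

lemma page_walk_in_N_sequences_iff:
  assumes "i \<ge> 1"
  shows "page_seq i \<circ> f \<in> N_sequences_to_infinity N discrete_open_book book_point \<longleftrightarrow>
    f 0 = 0 \<and> (\<forall>k. real i * \<bar>real (f k) - real (f (Suc k))\<bar> \<le> N) \<and> filterlim f at_top sequentially"
proof -
  have "filterlim (\<lambda>k. real i * real (f k)) at_top sequentially \<longleftrightarrow> filterlim f at_top sequentially"
    using assms
    by (simp add: filterlim_tendsto_pos_mult_at_top_iff[OF tendsto_const] filterlim_sequentially_iff_filterlim_real)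
  then show ?thesis using assms
    by (auto simp: N_sequences_to_infinity_def page_seq_eq_None_iff mdist_page_seq
        mdist_page_seq_book_point page_seq_in_book)
qed

section \<open>Reduction to a single page\<close>

text \<open>
  Once the wedge point is inserted between consecutive terms on different pages, a page can only
  be left through the wedge point, so nothing after the last visit there leaves its page.
\<close>
lemma N_sequence_equiv_on_one_page:
  assumes s: "s \<in> N_sequences_to_infinity N discrete_open_book book_point"
  obtains i f where "i \<ge> 1" "(s, page_seq i \<circ> f) \<in> seq_equiv N discrete_open_book book_point"
proof -
  let ?D = discrete_open_book
  have s_space: "s k \<in> mspace ?D" for k
    using s by (auto simp: N_sequences_to_infinity_def)
  then have "\<exists>i n. i \<ge> 1 \<and> s k = page_seq i n" for k
    unfolding mspace_discrete_open_book by blast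
  then obtain c a where c: "\<And>k. c k \<ge> 1" and sk: "\<And>k. s k = page_seq (c k) (a k)"
    by metis
  have step: "mdist ?D (s k) (s (Suc k)) \<le> N" for k
    using s by (simp add: N_sequences_to_infinity_def)
  \<comment> \<open>Two steps suffice for a change of page through the wedge point; a step within a page is
    preceded by one step of waiting, so that all paths have the same length.\<close>
  define P where "P k r = (if r = 0 then s k else if r \<ge> 2 then s (Suc k)
      else if c k = c (Suc k) then s k else None)" for k r :: nat
  define u where "u = concat_paths 2 P"
  have P_step: "mdist ?D (P k r) (P k (Suc r)) \<le> N \<and>
      (\<exists>i m n. P k r = page_seq i m \<and> P k (Suc r) = page_seq i n)" if "r < 2" for k r
  proof (cases "c k = c (Suc k)")
    case True
    with step[of k] c[of k] show ?thesis
      using that mdist_page_seq[OF c[of k] c[of k], of "a k"]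
      by (cases "r = 0") (auto simp: P_def sk intro: order_trans[rotated])
  next
    case False
    have *: "real (c k) * real (a k) + real (c (Suc k)) * real (a (Suc k)) \<le> N"
      using step[of k] False by (simp add: sk mdist_page_seq[OF c c])
    have "mdist ?D None (s (Suc k)) = real (c (Suc k)) * real (a (Suc k))"
      by (simp add: sk mdist_commute[of _ None] mdist_page_seq_book_point[OF c])
    moreover have "mdist ?D (s k) None = real (c k) * real (a k)"
      by (simp add: sk mdist_page_seq_book_point[OF c])
    moreover have "0 \<le> real (c k) * real (a k)" "0 \<le> real (c (Suc k)) * real (a (Suc k))"
      by simp_all
    ultimately have "mdist ?D (s k) None \<le> N" "mdist ?D None (s (Suc k)) \<le> N"
      using * by linarith+
    with that False show ?thesis
      by (cases "r = 0") (auto simp: P_def sk intro: page_seq_0[symmetric])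
  qed
  have P_space: "P k r \<in> mspace ?D" for k r
    using s_space book_point_in_book by (auto simp: P_def)
  have u: "u \<in> N_sequences_to_infinity N ?D book_point" and su: "(s, u) \<in> seq_equiv N ?D book_point"
    unfolding u_def using P_step P_space
    by (intro concat_paths_N_sequence[OF s book_point_in_book]; simp add: P_def)+
  \<comment> \<open>The wedge point lies on every page, so this does not prevent a change of page there.\<close>
  have common_page: "\<exists>i m n. u k = page_seq i m \<and> u (Suc k) = page_seq i n" for k
    unfolding u_def
    by (rule concat_paths_step[where P = P and L = 2 and n = k]) (use P_step in \<open>auto simp: P_def\<close>)
  have u0: "u 0 = None" using u by (simp add: N_sequences_to_infinity_def)
  have lim: "filterlim (\<lambda>k. mdist ?D (u k) None) at_top sequentially"
    using u by (simp add: N_sequences_to_infinity_def)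
  then have "eventually (\<lambda>k. mdist ?D (u k) None > 0) sequentially"
    by (simp add: filterlim_at_top_dense)
  then obtain M where M: "\<And>k. k \<ge> M \<Longrightarrow> mdist ?D (u k) None > 0"
    by (auto simp: eventually_sequentially)
  have "mdist ?D None None = 0" using book_point_in_book by simp
  then have "k < M" if "u k = None" for k
    using M[of k] that by (cases "k < M") simp_all
  then have "{k. u k = None} \<subseteq> {..<M}" by blast
  then have fin: "finite {k. u k = None}" by (rule finite_subset) simp
  define K where "K = Max {k. u k = None}"
  have uK: "u K = None" using Max_in[OF fin] u0 unfolding K_def by blast
  have after: "u k \<noteq> None" if "k > K" for k
  proof
    assume "u k = None"
    then have "k \<le> K" unfolding K_def by (intro Max_ge[OF fin]) simp
    with that show False by simp
  qed
  define w where "w n = u (n + K)" for n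
  have w0: "w 0 = None" by (simp add: w_def uK)
  have w: "w \<in> N_sequences_to_infinity N ?D book_point"
    using u filterlim_compose[OF lim filterlim_add_const_nat_at_top[of K]]
    by (auto simp: N_sequences_to_infinity_def w_def uK)
  have "strict_mono (\<lambda>n. n + K)" by (simp add: strict_mono_def)
  then have "is_subsequence w u"
    unfolding is_subsequence_def by (intro exI[of _ "\<lambda>n. n + K"]) (auto simp: w_def)
  then have uw: "(u, w) \<in> seq_equiv N ?D book_point"
    using u w by (intro seq_equivI) (auto simp: seq_sim_def)
  have "w 1 \<in> mspace ?D" using w by (auto simp: N_sequences_to_infinity_def)
  then obtain i m where i: "i \<ge> 1" and w1: "w 1 = page_seq i m"
    by (auto simp: mspace_discrete_open_book)
  \<comment> \<open>A point other than the wedge point determines its page, so two consecutive common pages agree.\<close>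
  have "\<exists>m. w (Suc n) = page_seq i m" for n
  proof (induction n)
    case 0
    then show ?case using w1 by auto
  next
    case (Suc n)
    then obtain p where p: "w (Suc n) = page_seq i p" by blast
    obtain j m q where j: "w (Suc n) = page_seq j m" "w (Suc (Suc n)) = page_seq j q"
      using common_page[of "Suc n + K"] by (auto simp: w_def)
    have "page_seq i p \<noteq> None" using after[of "Suc n + K"] p by (simp add: w_def)
    then have "i = j" using p j(1) page_seq_eq_imp_same_page by metis
    with j show ?case by blast
  qed
  then have "\<exists>m. w n = page_seq i m" for n
    using w0 page_seq_0 by (cases n) metis+
  then obtain f where "w = page_seq i \<circ> f" by (metis comp_apply ext)
  moreover have "(s, w) \<in> seq_equiv N ?D book_point"
    using su uw equiv_seq_equiv by (metis equivE transD)
  ultimately show ?thesis using i that by blast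
qed

section \<open>Walks on one page\<close>

text \<open>
  By the discrete intermediate value theorem, \<open>g\<close> attains \<open>n\<close> before it first attains \<open>Suc n\<close>.
\<close>
lemma first_hitting_times_strict_mono:
  fixes g :: "nat \<Rightarrow> nat"
  assumes g0: "g 0 = 0" and unit: "\<And>k. \<bar>int (g (Suc k)) - int (g k)\<bar> \<le> 1"
    and lim: "filterlim g at_top sequentially"
  obtains h where "strict_mono h" "\<And>n. g (h n) = n"
proof -
  have between: "\<exists>k\<le>m. g k = n" if "n \<le> g m" for m n
    using nat_intermed_int_val[of 0 m "int \<circ> g" "int n"] unit that g0 by (auto simp: abs_minus_commute)
  have "\<exists>k. g k = n" for n
  proof -
    have "eventually (\<lambda>k. n \<le> g k) sequentially" using lim by (simp add: filterlim_at_top)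
    then show ?thesis using between by (metis eventually_sequentially order_refl)
  qed
  then have hit: "g (LEAST k. g k = n) = n" for n by (rule LeastI_ex)
  have "(LEAST k. g k = n) < (LEAST k. g k = Suc n)" for n
  proof -
    obtain k where k: "k \<le> (LEAST k. g k = Suc n)" "g k = n"
      using between[of n "LEAST k. g k = Suc n"] hit[of "Suc n"] by auto
    then have "k \<noteq> (LEAST k. g k = Suc n)" using hit[of "Suc n"] by auto
    moreover have "(LEAST k. g k = n) \<le> k" by (rule Least_le) (rule k)
    ultimately show ?thesis using k by linarith
  qed
  with hit show ?thesis by (intro that[of "\<lambda>n. LEAST k. g k = n"]) (auto simp: strict_mono_Suc_iff)
qed

lemma page_seq_in_N_sequences:
  assumes "1 \<le> i" "i \<le> N"
  shows "page_seq i \<in> N_sequences_to_infinity (real N) discrete_open_book book_point"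
  using page_walk_in_N_sequences_iff[of i id "real N"] assms filterlim_ident by (simp add: id_def comp_def)

text \<open>
  A sequence on the page \<open>i\<close> that goes to infinity is not constant, so it makes a step between
  distinct points, and these are at distance at least \<open>i\<close>.
\<close>
lemma unbounded_walk_page_le:
  assumes i: "i \<ge> 1"
    and w: "page_seq i \<circ> f \<in> N_sequences_to_infinity (real N) discrete_open_book book_point"
  shows "i \<le> N"
proof (rule ccontr)
  assume "\<not> i \<le> N"
  have step: "real i * \<bar>real (f k) - real (f (Suc k))\<bar> \<le> real N" for k
    using w by (simp add: page_walk_in_N_sequences_iff[OF i])
  have "f (Suc k) = f k" for k
  proof (rule ccontr)
    assume "f (Suc k) \<noteq> f k"
    then have "1 \<le> \<bar>real (f k) - real (f (Suc k))\<bar>" by linarith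
    then have "real i \<le> real i * \<bar>real (f k) - real (f (Suc k))\<bar>"
      by (simp add: mult_le_cancel_left1)
    with step[of k] \<open>\<not> i \<le> N\<close> show False by simp
  qed
  then have const: "f k = f 0" for k by (induction k) auto
  have "filterlim f at_top sequentially"
    using w by (simp add: page_walk_in_N_sequences_iff[OF i])
  then have "eventually (\<lambda>k. Suc (f 0) \<le> f k) sequentially"
    by (simp add: filterlim_at_top)
  then show False using const by (metis Suc_n_not_le_n eventually_sequentially order_refl)
qed

text \<open>
  A step of length at most \<open>N\<close> moves the coordinate by at most \<open>N div i \<le> N\<close>, so \<open>N\<close> unit steps (or
  waits) suffice to fill it in, and unit steps are short enough because \<open>i \<le> N\<close>.
\<close>
lemma page_walk_equiv_page_seq:
  assumes i: "i \<ge> 1"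
    and w: "page_seq i \<circ> f \<in> N_sequences_to_infinity (real N) discrete_open_book book_point"
  shows "(page_seq i \<circ> f, page_seq i) \<in> seq_equiv (real N) discrete_open_book book_point"
proof -
  let ?D = discrete_open_book
  have "i \<le> N" by (rule unbounded_walk_page_le[OF i w])
  have gap: "\<bar>int (f k) - int (f (Suc k))\<bar> \<le> int N" for k
  proof -
    have "\<bar>real (f k) - real (f (Suc k))\<bar> \<le> real i * \<bar>real (f k) - real (f (Suc k))\<bar>"
      using i by (simp add: mult_le_cancel_right1)
    also have "\<dots> \<le> real N" using w by (simp add: page_walk_in_N_sequences_iff[OF i])
    finally show ?thesis by linarith
  qed
  \<comment> \<open>Walk from \<open>f k\<close> towards \<open>f (Suc k)\<close> in unit steps and wait there.\<close>
  define p where "p k r = (if f k \<le> f (Suc k) then min (f k + r) (f (Suc k))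
     else max (f k - r) (f (Suc k)))" for k r
  define g where "g = concat_paths N p"
  have unit: "\<bar>int (p k (Suc r)) - int (p k r)\<bar> \<le> 1" for k r
    by (auto simp: p_def)
  have start: "p k 0 = f k" and finish: "p k N = f (Suc k)" for k
    using gap[of k] by (auto simp: p_def)
  have "N > 0" using i \<open>i \<le> N\<close> by simp
  have P_step: "mdist ?D (page_seq i (p k r)) (page_seq i (p k (Suc r))) \<le> real N" for k r
  proof -
    have "\<bar>real (p k r) - real (p k (Suc r))\<bar> \<le> 1" using unit[of k r] by linarith
    then have "real i * \<bar>real (p k r) - real (p k (Suc r))\<bar> \<le> real i"
      by (simp add: mult_left_le)
    with \<open>i \<le> N\<close> show ?thesis by (simp add: mdist_page_seq[OF i i])
  qed
  have g_eq: "concat_paths N (\<lambda>k r. page_seq i (p k r)) = page_seq i \<circ> g"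
    by (auto simp: g_def concat_paths_def)
  have u: "page_seq i \<circ> g \<in> N_sequences_to_infinity (real N) ?D book_point"
    and wu: "(page_seq i \<circ> f, page_seq i \<circ> g) \<in> seq_equiv (real N) ?D book_point"
    unfolding g_eq[symmetric]
    by (intro concat_paths_N_sequence[OF w book_point_in_book \<open>N > 0\<close>];
        simp add: start finish P_step page_seq_in_book[OF i])+
  have "\<bar>int (g (Suc k)) - int (g k)\<bar> \<le> 1" for k
    unfolding g_def
    by (rule concat_paths_step[where P = p and n = k, OF \<open>N > 0\<close>]) (use unit in \<open>auto simp: start finish\<close>)
  moreover have "g 0 = 0" "filterlim g at_top sequentially"
    using u by (simp_all add: page_walk_in_N_sequences_iff[OF i])
  ultimately obtain h where h: "strict_mono h" "\<And>n. g (h n) = n"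
    using first_hitting_times_strict_mono by blast
  then have "page_seq i = (page_seq i \<circ> g) \<circ> h" by auto
  with h(1) have "is_subsequence (page_seq i) (page_seq i \<circ> g)"
    unfolding is_subsequence_def by blast
  then have "(page_seq i \<circ> g, page_seq i) \<in> seq_equiv (real N) ?D book_point"
    using u page_seq_in_N_sequences[OF i \<open>i \<le> N\<close>] by (intro seq_equivI) (auto simp: seq_sim_def)
  with wu show ?thesis using equiv_seq_equiv by (metis equivE transD)
qed

section \<open>The set of ends\<close>

theorem theorem3p3:
  fixes N :: nat
  assumes "N \<ge> 1"
  shows "sigma_ends (real N) discrete_open_book book_point =
    {seq_class (real N) discrete_open_book book_point (page_seq i) | i. i \<in> {1..N}}"
proof (intro equalityI subsetI)
  let ?S = "N_sequences_to_infinity (real N) discrete_open_book book_point"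
  let ?E = "seq_equiv (real N) discrete_open_book book_point"
  fix A assume "A \<in> sigma_ends (real N) discrete_open_book book_point"
  then obtain s where s: "s \<in> ?S" and A: "A = ?E `` {s}"
    by (auto simp: sigma_ends_def elim: quotientE)
  obtain i f where i: "i \<ge> 1" and sf: "(s, page_seq i \<circ> f) \<in> ?E"
    using N_sequence_equiv_on_one_page[OF s] .
  then have w: "page_seq i \<circ> f \<in> ?S" by (simp add: seq_equiv_def)
  have "(s, page_seq i) \<in> ?E"
    using sf page_walk_equiv_page_seq[OF i w] equiv_seq_equiv by (metis equivE transD)
  then have "A = ?E `` {page_seq i}"
    unfolding A by (rule equiv_class_eq[OF equiv_seq_equiv])
  with i unbounded_walk_page_le[OF i w]
  show "A \<in> {seq_class (real N) discrete_open_book book_point (page_seq i) | i. i \<in> {1..N}}"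
    by (auto simp: seq_class_def)
next
  fix A assume "A \<in> {seq_class (real N) discrete_open_book book_point (page_seq i) | i. i \<in> {1..N}}"
  then show "A \<in> sigma_ends (real N) discrete_open_book book_point"
    by (auto simp: sigma_ends_def seq_class_def intro!: quotientI page_seq_in_N_sequences)
qed

end
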